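(* Let $\mathrm{vec}(G)$ be any Gaussian vector defined on the joint space $MN$ ($m$ variables for $M$ and $n$ variables for $N$). Then there exist a Gaussian core vector $\mathrm{vec}(S_{\mathrm{core}})$ on $MN$ and a Gaussian operator $T$ on $M$ (no physicality requirement being imposed on either) such that $$\mathrm{vec}(G)=(T\otimes\mathbb 1)\,\mathrm{vec}(S_{\mathrm{core}}),$$ where $T\otimes \mathbb 1$ acts as the identity on $N$. This decomposition can be computed in time quadratic in the number of variables of $\mathrm{vec}(G)$; in fact each entry of the Ab parametrizations of $T$ and $S_{\mathrm{core}}$ can be computed in constant time.
   Context: A Gaussian function on $\mathbb C^k$ is $F(\zeta)=c\exp(\tfrac12\zeta^{\mathrm T}A\zeta+\zeta^{\mathrm T}b)$ with $A\in\mathbb C^{k\times k}$ symmetric, $b\in\mathbb C^k$, $c\in\mathbb C$; $(A,b,c)$ is its Abc (and $(A,b)$ its Ab) parametrization. A Gaussian operator is an object whose Bargmann function $F_G$ is a Gaussian function; its vectorization is the formal vector $\mathrm{vec}(G)=F_G(a_1^\dagger,\dots,a_k^\dagger)|0^k\rangle$, i.e. the (possibly non-normalizable) formal vector with Bargmann function $F_G$. Its Fock coefficient at $\ell\in\mathbb N^k$ is $\frac{1}{\sqrt{\ell!}}\partial^\ell F_G(0)$. A Gaussian vector on $MN$ with Bargmann function $F(z,v)$, $z\in\mathbb C^m$, $v\in\mathbb C^n$, is a Gaussian core vector if for every $k\in\mathbb N^n$ only finitely many of its Fock coefficients with index $(j,k)$, $j\in\mathbb N^m$, are nonzero (finite Fock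 support on $M$ when $N$ is projected onto number states). A Gaussian operator $T$ on $M$ with Bargmann function $F_T(z,w)$ ($z,w\in\mathbb C^m$ the output and input variables) acts on a vector with Bargmann function $F(w,v)$ through $F_{(T\otimes\mathbb 1)F}(z,v)=\int_{\mathbb C^m}\frac{d^{2m}w}{\pi^m}e^{-\|w\|^2}F_T(z,w^* )F(w,v)$. *)

theory Defs
  imports "HOL-Analysis.Analysis" "Jordan_Normal_Form.Matrix"
begin

unbundle no vec_syntax
unbundle no inner_syntax

section \<open>Gaussian functions\<close>

record abc =
  abc_A :: "complex mat"
  abc_b :: "complex vec"
  abc_c :: complex

definition is_abc :: "nat \<Rightarrow> abc \<Rightarrow> bool" where
  "is_abc k p \<longleftrightarrow>
     abc_A p \<in> carrier_mat k k \<and> transpose_mat (abc_A p) = abc_A p \<and>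
     abc_b p \<in> carrier_vec k"

definition gaussian_fun :: "abc \<Rightarrow> complex vec \<Rightarrow> complex" where
  "gaussian_fun p \<zeta> =
     abc_c p * exp (1 / 2 * (\<zeta> \<bullet> (abc_A p *\<^sub>v \<zeta>)) + \<zeta> \<bullet> abc_b p)"

text \<open>
  Formal vectors and operators are represented by their Bargmann functions. A function on
  \<open>\<complex>\<^sup>k\<close> is a total function on \<^typ>\<open>complex vec\<close> of which only the
  values on \<^term>\<open>carrier_vec k\<close> matter; equality of formal vectors is equality of
  Bargmann functions there. An operator on \<open>m\<close> variables has a Bargmann function on
  \<open>\<complex>\<^sup>2\<^sup>m\<close>, the output variables coming first.
\<close>

definition has_abc :: "nat \<Rightarrow> (complex vec \<Rightarrow> complex) \<Rightarrow> abc \<Rightarrow> bool" where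
  "has_abc k F p \<longleftrightarrow> is_abc k p \<and> (\<forall>\<zeta>\<in>carrier_vec k. F \<zeta> = gaussian_fun p \<zeta>)"

definition gaussian_vector :: "nat \<Rightarrow> (complex vec \<Rightarrow> complex) \<Rightarrow> bool" where
  "gaussian_vector k F \<longleftrightarrow> (\<exists>p. has_abc k F p)"

definition gaussian_operator :: "nat \<Rightarrow> (complex vec \<Rightarrow> complex) \<Rightarrow> bool" where
  "gaussian_operator m T \<longleftrightarrow> (\<exists>p. has_abc (2 * m) T p)"


section \<open>Fock coefficients and core vectors\<close>

definition partial_deriv ::
  "nat \<Rightarrow> nat \<Rightarrow> (complex vec \<Rightarrow> complex) \<Rightarrow> complex vec \<Rightarrow> complex" where
  "partial_deriv k i F = (\<lambda>\<zeta>. deriv (\<lambda>t. F (\<zeta> + t \<cdot>\<^sub>v unit_vec k i)) 0)"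

definition multi_deriv ::
  "nat \<Rightarrow> nat vec \<Rightarrow> (complex vec \<Rightarrow> complex) \<Rightarrow> complex vec \<Rightarrow> complex" where
  "multi_deriv k l F = foldr (\<lambda>i. partial_deriv k i ^^ (l $ i)) [0..<k] F"

definition fock_coeff :: "nat \<Rightarrow> (complex vec \<Rightarrow> complex) \<Rightarrow> nat vec \<Rightarrow> complex" where
  "fock_coeff k F l =
     1 / complex_of_real (sqrt (\<Prod>i<k. fact (l $ i))) * multi_deriv k l F (0\<^sub>v k)"

definition gaussian_core_vector :: "nat \<Rightarrow> nat \<Rightarrow> (complex vec \<Rightarrow> complex) \<Rightarrow> bool" where
  "gaussian_core_vector m n F \<longleftrightarrow>
     gaussian_vector (m + n) F \<and>
     (\<forall>k\<in>carrier_vec n. finite {j \<in> carrier_vec m. fock_coeff (m + n) F (j @\<^sub>v k) \<noteq> 0})"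


section \<open>Action of an operator on the first m variables\<close>

definition op_integrand ::
  "nat \<Rightarrow> (complex vec \<Rightarrow> complex) \<Rightarrow> (complex vec \<Rightarrow> complex) \<Rightarrow>
   complex vec \<Rightarrow> complex vec \<Rightarrow> (nat \<Rightarrow> complex) \<Rightarrow> complex" where
  "op_integrand m T F z v w =
     complex_of_real (exp (- (\<Sum>i<m. (cmod (w i))\<^sup>2)) / pi ^ m) *
       T (z @\<^sub>v conjugate (Matrix.vec m w)) * F (Matrix.vec m w @\<^sub>v v)"

text \<open>
  \<open>vec(G) = (T \<otimes> 1) vec(F)\<close>. The measure on \<open>\<complex>\<^sup>m\<close> is the product of \<open>m\<close> copies
  of the Lebesgue measure of the plane. Integrability is required explicitly, because a
  divergent Bochner integral has the value 0 in the library.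
\<close>

definition op_maps_to ::
  "nat \<Rightarrow> nat \<Rightarrow> (complex vec \<Rightarrow> complex) \<Rightarrow> (complex vec \<Rightarrow> complex) \<Rightarrow>
   (complex vec \<Rightarrow> complex) \<Rightarrow> bool" where
  "op_maps_to m n T F G \<longleftrightarrow>
     (\<forall>z\<in>carrier_vec m. \<forall>v\<in>carrier_vec n.
        integrable (\<Pi>\<^sub>M i\<in>{..<m}. lborel) (op_integrand m T F z v) \<and>
        G (z @\<^sub>v v) = (LINT w|(\<Pi>\<^sub>M i\<in>{..<m}. lborel). op_integrand m T F z v w))"


section \<open>Unit-cost machine\<close>

text \<open>
  Running times refer to an algebraic random access machine: named natural-number registers
  for indices and named two-dimensional arrays of complex numbers (a vector is stored in
  column 0, a scalar in cell (0,0)). The only complex constants are 0 and 1. Every assignment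
  and every evaluation of a test costs one step; as a program is a fixed finite object,
  charging for each arithmetic operation separately would change running times by at most a
  constant factor depending on the program only.
\<close>

datatype iexp = ILit nat | IReg string | IPlus iexp iexp | IMinus iexp iexp

datatype cexp = CZero | COne | CCell string iexp iexp
  | CPlus cexp cexp | CMinus cexp cexp | CTimes cexp cexp | CDivide cexp cexp

datatype test = TLess iexp iexp | TIsZero cexp | TNot test | TAnd test test

datatype prog = PSkip
  | PSetReg string iexp
  | PSetCell string iexp iexp cexp
  | PSeq prog prog
  | PIf test prog prog
  | PWhile test prog

record store =
  reg :: "string \<Rightarrow> nat"
  cell :: "string \<Rightarrow> nat \<Rightarrow> nat \<Rightarrow> complex"

primrec ival :: "store \<Rightarrow> iexp \<Rightarrow> nat" where
  "ival s (ILit a) = a"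
| "ival s (IReg x) = reg s x"
| "ival s (IPlus e f) = ival s e + ival s f"
| "ival s (IMinus e f) = ival s e - ival s f"

primrec cval :: "store \<Rightarrow> cexp \<Rightarrow> complex" where
  "cval s CZero = 0"
| "cval s COne = 1"
| "cval s (CCell X e f) = cell s X (ival s e) (ival s f)"
| "cval s (CPlus a b) = cval s a + cval s b"
| "cval s (CMinus a b) = cval s a - cval s b"
| "cval s (CTimes a b) = cval s a * cval s b"
| "cval s (CDivide a b) = cval s a / cval s b"

primrec tval :: "store \<Rightarrow> test \<Rightarrow> bool" where
  "tval s (TLess e f) \<longleftrightarrow> ival s e < ival s f"
| "tval s (TIsZero a) \<longleftrightarrow> cval s a = 0"
| "tval s (TNot b) \<longleftrightarrow> \<not> tval s b"
| "tval s (TAnd b d) \<longleftrightarrow> tval s b \<and> tval s d"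

definition set_reg :: "string \<Rightarrow> nat \<Rightarrow> store \<Rightarrow> store" where
  "set_reg x a s = s\<lparr>reg := (reg s)(x := a)\<rparr>"

definition set_cell :: "string \<Rightarrow> nat \<Rightarrow> nat \<Rightarrow> complex \<Rightarrow> store \<Rightarrow> store" where
  "set_cell X i j a s = s\<lparr>cell := (cell s)(X := (cell s X)(i := (cell s X i)(j := a)))\<rparr>"

text \<open>\<open>exec P s t s'\<close>: started in \<open>s\<close>, the program \<open>P\<close> halts in \<open>s'\<close> after \<open>t\<close> steps.\<close>

inductive exec :: "prog \<Rightarrow> store \<Rightarrow> nat \<Rightarrow> store \<Rightarrow> bool" where
  Skip: "exec PSkip s 1 s"
| SetReg: "exec (PSetReg x e) s 1 (set_reg x (ival s e) s)"
| SetCell: "exec (PSetCell X e f a) s 1 (set_cell X (ival s e) (ival s f) (cval s a) s)"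
| Seq: "exec P s t s' \<Longrightarrow> exec Q s' u s'' \<Longrightarrow> exec (PSeq P Q) s (t + u) s''"
| IfTrue: "tval s b \<Longrightarrow> exec P s t s' \<Longrightarrow> exec (PIf b P Q) s (1 + t) s'"
| IfFalse: "\<not> tval s b \<Longrightarrow> exec Q s t s' \<Longrightarrow> exec (PIf b P Q) s (1 + t) s'"
| WhileFalse: "\<not> tval s b \<Longrightarrow> exec (PWhile b P) s 1 s"
| WhileTrue: "tval s b \<Longrightarrow> exec P s t s' \<Longrightarrow> exec (PWhile b P) s' u s'' \<Longrightarrow>
    exec (PWhile b P) s (1 + t + u) s''"

definition halts_within :: "prog \<Rightarrow> store \<Rightarrow> nat \<Rightarrow> (store \<Rightarrow> bool) \<Rightarrow> bool" where
  "halts_within P s N post \<longleftrightarrow> (\<exists>t s'. exec P s t s' \<and> t \<le> N \<and> post s')"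

definition stores_abc :: "string \<Rightarrow> string \<Rightarrow> string \<Rightarrow> nat \<Rightarrow> abc \<Rightarrow> store \<Rightarrow> bool" where
  "stores_abc X Y Z k p s \<longleftrightarrow>
     (\<forall>i<k. \<forall>j<k. cell s X i j = abc_A p $$ (i, j)) \<and>
     (\<forall>i<k. cell s Y i 0 = abc_b p $ i) \<and>
     cell s Z 0 0 = abc_c p"

text \<open>Registers and cells other than those mentioned here have arbitrary initial contents.\<close>

definition input_store :: "nat \<Rightarrow> nat \<Rightarrow> abc \<Rightarrow> store \<Rightarrow> bool" where
  "input_store m n p s \<longleftrightarrow>
     reg s ''m'' = m \<and> reg s ''n'' = n \<and> stores_abc ''A'' ''b'' ''c'' (m + n) p s"

text \<open>
  One program, not depending on \<open>m\<close>, \<open>n\<close> or the input, computes the complete Abc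
  parametrizations \<open>pS\<close>, \<open>pT\<close> of a vector on \<open>m + n\<close> and an operator on \<open>m\<close> variables.
\<close>

definition computes_decomposition ::
  "prog \<Rightarrow> nat \<Rightarrow> nat \<Rightarrow> nat \<Rightarrow> abc \<Rightarrow> abc \<Rightarrow> abc \<Rightarrow> bool" where
  "computes_decomposition P N m n pG pS pT \<longleftrightarrow>
     (\<forall>s. input_store m n pG s \<longrightarrow>
        halts_within P s N
          (\<lambda>s'. stores_abc ''A_S'' ''b_S'' ''c_S'' (m + n) pS s' \<and>
                stores_abc ''A_T'' ''b_T'' ''c_T'' (2 * m) pT s'))"

text \<open>
  Entrywise computation: the requested index is passed in the registers \<open>i\<close>, \<open>j\<close> (only
  \<open>i\<close> for the vector), and the result is delivered in cell (0,0) of \<open>out\<close>.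
\<close>

definition computes_Ab_entries ::
  "prog \<Rightarrow> prog \<Rightarrow> nat \<Rightarrow> nat \<Rightarrow> nat \<Rightarrow> abc \<Rightarrow> nat \<Rightarrow> abc \<Rightarrow> bool" where
  "computes_Ab_entries QA Qb N m n pG k p \<longleftrightarrow>
     (\<forall>s i j. input_store m n pG s \<and> reg s ''i'' = i \<and> reg s ''j'' = j \<and> i < k \<and> j < k \<longrightarrow>
        halts_within QA s N (\<lambda>s'. cell s' ''out'' 0 0 = abc_A p $$ (i, j))) \<and>
     (\<forall>s i. input_store m n pG s \<and> reg s ''i'' = i \<and> i < k \<longrightarrow>
        halts_within Qb s N (\<lambda>s'. cell s' ''out'' 0 0 = abc_b p $ i))"

end

theory Submission
  imports Defs "HOL-Probability.Characteristic_Functions"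
begin

unbundle no vec_syntax
unbundle no inner_syntax

text \<open>
  Write the exponent of \<open>G\<close> at \<open>(z, v)\<close> as \<open>q(z) + z\<^sup>T B v + r(v)\<close>, with \<open>q\<close> and \<open>r\<close>
  polynomials of degree at most 2. Since \<open>\<integral> e\<^bsup>-|w|\<^sup>2\<^esup> e\<^bsup>\<alpha> w\<^sup>* + \<beta> w\<^esup> dw = \<pi> e\<^bsup>\<alpha> \<beta>\<^esup>\<close>,
  the kernel \<open>exp (q(z) + z\<^sup>T w\<^sup>*)\<close> turns \<open>c exp (w\<^sup>T B v + r(v))\<close> into \<open>G\<close>. The latter is a core
  vector: its expansion contains \<open>w\<close> only through \<open>w\<^sup>T B v\<close>, so the coefficient of \<open>w\<^sup>j v\<^sup>k\<close>
  vanishes for \<open>|j| > |k|\<close>. The entries of both parametrizations are entries of the given one, 0 or 1.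
\<close>

section \<open>Gaussian integrals\<close>

text \<open>The imaginary part of \<open>s\<close> is a frequency in the characteristic function of
  the standard normal law; the real part is absorbed by completing the square, i.e. by a real shift
  of \<open>x\<close>. No contour has to be moved.\<close>

lemma gaussian_fourier_real:
  fixes s :: complex
  shows "has_bochner_integral lborel (\<lambda>x::real. exp (- (of_real x)\<^sup>2 + s * of_real x))
    (of_real (sqrt pi) * exp (s\<^sup>2 / 4))"
proof -
  interpret real_distribution std_normal_distribution by (rule real_dist_normal_dist)
  define q where "q = sqrt 2 * Im s / 2"
  define p where "p = Re s"
  have int: "integrable std_normal_distribution (\<lambda>x. iexp (q * x))"
    by (rule integrable_iexp) auto
  have "has_bochner_integral std_normal_distribution (\<lambda>x. iexp (q * x)) (of_real (exp (- (q^2) / 2)))"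
    using int fun_cong[OF char_std_normal_distribution, of q]
    unfolding has_bochner_integral_iff char_def by simp
  then have "has_bochner_integral lborel (\<lambda>x. std_normal_density x *\<^sub>R iexp (q * x)) (of_real (exp (- (q^2) / 2)))"
    unfolding has_bochner_integral_iff
    by (subst (asm) integrable_density, simp_all, subst (asm) integral_density, simp_all)
  then have 2: "has_bochner_integral lborel (\<lambda>x. std_normal_density (- p / sqrt 2 + sqrt 2 * x) *\<^sub>R iexp (q * (- p / sqrt 2 + sqrt 2 * x)))
    (of_real (exp (- (q^2) / 2)) /\<^sub>R \<bar>sqrt 2\<bar>)"
    by (subst (asm) lborel_has_bochner_integral_real_affine_iff[where c="sqrt 2" and t="- p / sqrt 2"]) simp_all
  \<comment> \<open>\<open>K\<close> cancels the normalisation of the density together with the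
    factor \<open>exp (- p^2 / 4)\<close> and the phase produced by the shift.\<close>
  define K where "K = of_real (sqrt (2 * pi)) * exp (of_real (p\<^sup>2 / 4) + \<i> * of_real (q * p / sqrt 2))"
  have e1: "K * (std_normal_density (- p / sqrt 2 + sqrt 2 * x) *\<^sub>R iexp (q * (- p / sqrt 2 + sqrt 2 * x)))
     = exp (- (of_real x)\<^sup>2 + s * of_real x)" for x
  proof -
    have "K * (std_normal_density (- p / sqrt 2 + sqrt 2 * x) *\<^sub>R iexp (q * (- p / sqrt 2 + sqrt 2 * x)))
      = exp (of_real (p\<^sup>2 / 4) + \<i> * of_real (q * p / sqrt 2) + of_real (- (- p / sqrt 2 + sqrt 2 * x)\<^sup>2 / 2)
          + \<i> * of_real (q * (- p / sqrt 2 + sqrt 2 * x)))"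
      unfolding K_def std_normal_density_def exp_add scaleR_conv_of_real exp_of_real by simp
    also have "of_real (p\<^sup>2 / 4) + \<i> * of_real (q * p / sqrt 2) + of_real (- (- p / sqrt 2 + sqrt 2 * x)\<^sup>2 / 2)
          + \<i> * of_real (q * (- p / sqrt 2 + sqrt 2 * x)) = - (of_real x)\<^sup>2 + s * of_real x"
      by (simp add: complex_eq_iff p_def q_def power2_eq_square field_simps)
    finally show ?thesis .
  qed
  have e2: "K * (of_real (exp (- (q^2) / 2)) /\<^sub>R \<bar>sqrt 2\<bar>) = of_real (sqrt pi) * exp (s\<^sup>2 / 4)"
  proof -
    have "K * (of_real (exp (- (q^2) / 2)) /\<^sub>R \<bar>sqrt 2\<bar>) = of_real (sqrt pi) *
       exp (of_real (p\<^sup>2 / 4) + \<i> * of_real (q * p / sqrt 2) + of_real (- (q^2) / 2))"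
      unfolding K_def exp_add scaleR_conv_of_real exp_of_real by (simp add: real_sqrt_mult)
    also have "of_real (p\<^sup>2 / 4) + \<i> * of_real (q * p / sqrt 2) + of_real (- (q^2) / 2) = s\<^sup>2 / 4"
      by (simp add: complex_eq_iff p_def q_def power2_eq_square field_simps)
    finally show ?thesis .
  qed
  show ?thesis using has_bochner_integral_mult_right[where c=K, OF 2] unfolding e1 e2 by simp
qed

text \<open>For \<open>w = x + \<i> y\<close> the exponent \<open>a * cnj w + b * w\<close> is
  \<open>(a + b) x + \<i> (b - a) y\<close>, so the integrand splits into two real Gaussians, and
  \<open>(a + b)^2 / 4 - (b - a)^2 / 4 = a b\<close>.\<close>

lemma complex_gaussian_integral:
  fixes a b :: complex
  shows "has_bochner_integral lborel (\<lambda>w::complex. of_real (exp (- (cmod w)\<^sup>2)) * exp (a * cnj w + b * w))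
    (of_real pi * exp (a * b))"
proof -
  \<comment> \<open>The factors are indexed by the basis elements 1 and \<open>\<i>\<close>, since
    \<open>lborel_eq\<close> presents the measure of the plane as the image of a product over
    \<open>Basis\<close>.\<close>
  define g where "g c = (\<lambda>x::real. exp (- (of_real x)\<^sup>2 + (if c = (1::complex) then a + b else \<i> * (b - a)) * of_real x))" for c
  have B: "(Basis :: complex set) = {1, \<i>}" by (simp add: Basis_complex_def)
  have ne: "(1::complex) \<noteq> \<i>" by (simp add: complex_eq_iff)
  interpret product_sigma_finite "\<lambda>b::complex. lborel :: real measure" ..
  have int: "integrable lborel (g c)" "integral\<^sup>L lborel (g c) = of_real (sqrt pi) * exp ((if c = (1::complex) then a + b else \<i> * (b - a))\<^sup>2 / 4)" for c
    using gaussian_fourier_real[of "if c = (1::complex) then a + b else \<i> * (b - a)"]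
    unfolding g_def has_bochner_integral_iff by blast+
  have eq: "of_real (exp (- (cmod (\<Sum>c\<in>Basis. f c *\<^sub>R c))\<^sup>2)) * exp (a * cnj (\<Sum>c\<in>Basis. f c *\<^sub>R c) + b * (\<Sum>c\<in>Basis. f c *\<^sub>R c))
     = (\<Prod>c\<in>Basis. g c (f c))" for f :: "complex \<Rightarrow> real"
    using ne
    by (simp add: B g_def cmod_power2 flip: exp_add of_real_exp exp_of_real)
      (simp add: algebra_simps scaleR_conv_of_real)
  have "(\<Prod>c\<in>Basis. of_real (sqrt pi) * exp ((if c = (1::complex) then a + b else \<i> * (b - a))\<^sup>2 / 4)) = of_real pi * exp (a * b)"
  proof -
    have "(a + b)\<^sup>2 / 4 + (\<i> * (b - a))\<^sup>2 / 4 = a * b"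
      by (simp add: power2_eq_square field_simps)
    then show ?thesis
      using ne by (simp add: B mult_ac flip: exp_add of_real_mult)
  qed
  then have "has_bochner_integral (\<Pi>\<^sub>M c\<in>(Basis::complex set). (lborel::real measure)) (\<lambda>f. \<Prod>c\<in>Basis. g c (f c)) (of_real pi * exp (a * b))"
    unfolding has_bochner_integral_iff
    using product_integrable_prod[of Basis g, OF _ int(1)] product_integral_prod[of Basis g, OF _ int(1)] int(2)
    by simp
  moreover have "(\<lambda>w::complex. of_real (exp (- (cmod w)\<^sup>2)) * exp (a * cnj w + b * w)) \<in> borel_measurable borel"
    by (intro borel_measurable_continuous_onI continuous_intros)
  ultimately show ?thesis
    unfolding has_bochner_integral_iff
    by (subst lborel_eq, subst (2) lborel_eq) (simp add: integrable_distr_eq integral_distr eq del: cnj_sum)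
qed

section \<open>Fock support of a core vector\<close>

text \<open>
  Polynomials on \<open>\<complex>\<^sup>k\<close> of degree strictly less than \<open>d\<close> in the first \<open>m\<close> coordinates. The strict
  inequality makes index 0 contain only the zero polynomial, so truncated subtraction
  describes differentiation correctly.
\<close>

inductive graded_poly :: "nat \<Rightarrow> nat \<Rightarrow> nat \<Rightarrow> (complex vec \<Rightarrow> complex) \<Rightarrow> bool"
  for m k :: nat where
  zero: "graded_poly m k d (\<lambda>\<zeta>. 0)"
| const: "graded_poly m k (Suc d) (\<lambda>\<zeta>. c)"
| add: "graded_poly m k d f \<Longrightarrow> graded_poly m k d g \<Longrightarrow> graded_poly m k d (\<lambda>\<zeta>. f \<zeta> + g \<zeta>)"
| smult: "graded_poly m k d f \<Longrightarrow> graded_poly m k d (\<lambda>\<zeta>. c * f \<zeta>)"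
| low: "graded_poly m k d f \<Longrightarrow> i < m \<Longrightarrow> graded_poly m k (Suc d) (\<lambda>\<zeta>. \<zeta> $ i * f \<zeta>)"
| high: "graded_poly m k d f \<Longrightarrow> m \<le> i \<Longrightarrow> i < k \<Longrightarrow> graded_poly m k d (\<lambda>\<zeta>. \<zeta> $ i * f \<zeta>)"

lemma graded_poly_Suc: "graded_poly m k d f \<Longrightarrow> graded_poly m k (Suc d) f"
  by (induction rule: graded_poly.induct) (auto intro: graded_poly.intros)

lemma graded_poly_0: "graded_poly m k d f \<Longrightarrow> d = 0 \<Longrightarrow> f = (\<lambda>\<zeta>. 0)"
  by (induction rule: graded_poly.induct) auto

lemma graded_poly_sum:
  "finite I \<Longrightarrow> (\<And>a. a \<in> I \<Longrightarrow> graded_poly m k d (f a)) \<Longrightarrow> graded_poly m k d (\<lambda>\<zeta>. \<Sum>a\<in>I. f a \<zeta>)"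
  by (induction rule: finite_induct) (auto intro: graded_poly.intros)

lemma graded_poly_times_coord:
  assumes "graded_poly m k d f" "i < k"
  shows "graded_poly m k (Suc d) (\<lambda>\<zeta>. \<zeta> $ i * f \<zeta>)"
  using assms by (cases "i < m") (auto intro: graded_poly.intros graded_poly_Suc)

section \<open>Derivatives of graded polynomials\<close>

lemma coord_line_has_derivative:
  fixes \<zeta> :: "complex vec"
  assumes "\<zeta> \<in> carrier_vec k" "i < k" "a < k"
  shows "((\<lambda>t. (\<zeta> + t \<cdot>\<^sub>v unit_vec k i) $ a) has_field_derivative (if a = i then 1 else 0)) (at 0)"
proof -
  have "(\<lambda>t. (\<zeta> + t \<cdot>\<^sub>v unit_vec k i) $ a) = (\<lambda>t. \<zeta> $ a + t * (if a = i then 1 else 0))"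
    using assms by (auto simp: unit_vec_def)
  then show ?thesis by (auto intro!: derivative_eq_intros)
qed

lemma line_at_0:
  fixes \<zeta> :: "complex vec"
  assumes "\<zeta> \<in> carrier_vec k"
  shows "\<zeta> + 0 \<cdot>\<^sub>v unit_vec k i = \<zeta>"
  using assms by (intro eq_vecI) auto

lemma coord_times_has_derivative:
  fixes \<zeta> :: "complex vec"
  assumes "\<zeta> \<in> carrier_vec k" "i < k" "a < k"
    and "((\<lambda>t. f (\<zeta> + t \<cdot>\<^sub>v unit_vec k i)) has_field_derivative f') (at 0)"
  shows "((\<lambda>t. (\<zeta> + t \<cdot>\<^sub>v unit_vec k i) $ a * f (\<zeta> + t \<cdot>\<^sub>v unit_vec k i)) has_field_derivative
    (if a = i then 1 else 0) * f \<zeta> + \<zeta> $ a * f') (at 0)"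
  using DERIV_mult[OF coord_line_has_derivative[OF assms(1-3)] assms(4)]
  by (simp only: line_at_0[OF assms(1)] mult.commute[of f'])

text \<open>Product rule along the constructors: a derivative in one of the first \<open>m\<close>
  coordinates costs one degree, any other costs none. Differentiability is part of the conclusion
  because the product rule asks for it.\<close>

lemma graded_poly_derivative:
  assumes "graded_poly m k d f" "i < k" "m \<le> k"
  shows "\<exists>g. graded_poly m k (if i < m then d - 1 else d) g \<and> (\<forall>\<zeta>\<in>carrier_vec k.
    ((\<lambda>t. f (\<zeta> + t \<cdot>\<^sub>v unit_vec k i)) has_field_derivative g \<zeta>) (at 0))"
  using assms
proof (induction rule: graded_poly.induct)
  case (zero d)
  then show ?case by (intro exI[of _ "\<lambda>_. 0"]) (auto intro: graded_poly.intros)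
next
  case (const d c)
  then show ?case by (intro exI[of _ "\<lambda>_. 0"]) (auto intro: graded_poly.intros)
next
  case (add d f g)
  then obtain f' g' where "graded_poly m k (if i < m then d - 1 else d) f'" "graded_poly m k (if i < m then d - 1 else d) g'"
    "\<forall>\<zeta>\<in>carrier_vec k. ((\<lambda>t. f (\<zeta> + t \<cdot>\<^sub>v unit_vec k i)) has_field_derivative f' \<zeta>) (at 0)"
    "\<forall>\<zeta>\<in>carrier_vec k. ((\<lambda>t. g (\<zeta> + t \<cdot>\<^sub>v unit_vec k i)) has_field_derivative g' \<zeta>) (at 0)"
    by metis
  then show ?case
    by (intro exI[of _ "\<lambda>\<zeta>. f' \<zeta> + g' \<zeta>"]) (auto intro: graded_poly.add intro!: DERIV_add)
next
  case (smult d f c)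
  then obtain f' where "graded_poly m k (if i < m then d - 1 else d) f'"
    "\<forall>\<zeta>\<in>carrier_vec k. ((\<lambda>t. f (\<zeta> + t \<cdot>\<^sub>v unit_vec k i)) has_field_derivative f' \<zeta>) (at 0)"
    by metis
  then show ?case
    by (intro exI[of _ "\<lambda>\<zeta>. c * f' \<zeta>"]) (auto intro: graded_poly.smult intro!: DERIV_cmult)
next
  case (low d f a)
  then obtain f' where f': "graded_poly m k (if i < m then d - 1 else d) f'"
    "\<And>\<zeta>. \<zeta>\<in>carrier_vec k \<Longrightarrow> ((\<lambda>t. f (\<zeta> + t \<cdot>\<^sub>v unit_vec k i)) has_field_derivative f' \<zeta>) (at 0)"
    by metis
  show ?case
  \<comment> \<open>Here \<open>Suc (d - 1)\<close> is 1 and not \<open>d\<close>, so the grading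
    from the product rule is too weak; but index 0 forces \<open>f = 0\<close>.\<close>
  proof (cases "i < m \<and> d = 0")
    case True
    then have "f = (\<lambda>_. 0)" using low graded_poly_0 by blast
    with True show ?thesis by (intro exI[of _ "\<lambda>_. 0"]) (auto intro: graded_poly.intros)
  next
    case False
    have 1: "graded_poly m k (if i < m then d else Suc d) (\<lambda>\<zeta>. \<zeta> $ a * f' \<zeta>)"
      using False f'(1) graded_poly.low[OF f'(1) \<open>a < m\<close>] by (auto split: if_splits)
    have 2: "graded_poly m k (if i < m then d else Suc d) (\<lambda>\<zeta>. (if a = i then 1 else 0) * f \<zeta>)"
      using low by (auto intro: graded_poly.intros graded_poly_Suc simp del: mult_1)
    have "a < k"
      using low.hyps low.prems by simp
    note D = coord_times_has_derivative[OF _ \<open>i < k\<close> this f'(2)]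
    show ?thesis
      unfolding diff_Suc_1
      by (rule exI, rule conjI, rule graded_poly.add[OF 2 1], rule ballI, rule D)
  qed
next
  case (high d f a)
  then obtain f' where f': "graded_poly m k (if i < m then d - 1 else d) f'"
    "\<And>\<zeta>. \<zeta>\<in>carrier_vec k \<Longrightarrow> ((\<lambda>t. f (\<zeta> + t \<cdot>\<^sub>v unit_vec k i)) has_field_derivative f' \<zeta>) (at 0)"
    by metis
  have 1: "graded_poly m k (if i < m then d - 1 else d) (\<lambda>\<zeta>. \<zeta> $ a * f' \<zeta>)"
    using f'(1) high by (intro graded_poly.high) auto
  have 2: "graded_poly m k (if i < m then d - 1 else d) (\<lambda>\<zeta>. (if a = i then 1 else 0) * f \<zeta>)"
    using high by (auto intro: graded_poly.intros simp del: mult_1)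
  note D = coord_times_has_derivative[OF _ \<open>i < k\<close> \<open>a < k\<close> f'(2)]
  show ?case
    by (rule exI, rule conjI, rule graded_poly.add[OF 2 1], rule ballI, rule D)
qed

section \<open>Derivatives of Gaussian functions\<close>

lemma quadratic_form_sum:
  fixes \<zeta> :: "complex vec"
  assumes "A \<in> carrier_mat k k" "\<zeta> \<in> carrier_vec k"
  shows "\<zeta> \<bullet> (A *\<^sub>v \<zeta>) = (\<Sum>a<k. \<Sum>b<k. \<zeta> $ a * A $$ (a, b) * \<zeta> $ b)"
  using assms by (simp add: scalar_prod_def lessThan_atLeast0 sum_distrib_left mult.assoc)

text \<open>Component \<open>i\<close> of \<open>A \<zeta> + b\<close>, the logarithmic derivative
  of the Gaussian in direction \<open>i\<close>.\<close>

definition gaussian_gradient :: "abc \<Rightarrow> nat \<Rightarrow> complex vec \<Rightarrow> complex" where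
  "gaussian_gradient p i \<zeta> = (\<Sum>a<dim_vec (abc_b p). abc_A p $$ (i, a) * \<zeta> $ a) + abc_b p $ i"

lemma gaussian_fun_eq_sums:
  assumes "is_abc k p" "\<zeta> \<in> carrier_vec k"
  shows "gaussian_fun p \<zeta> = abc_c p *
    exp (1 / 2 * (\<Sum>a<k. \<Sum>b<k. \<zeta> $ a * abc_A p $$ (a, b) * \<zeta> $ b) + (\<Sum>a<k. \<zeta> $ a * abc_b p $ a))"
  using assms
  by (auto simp: gaussian_fun_def quadratic_form_sum[of _ k] is_abc_def scalar_prod_def[of \<zeta> "abc_b p"]
      lessThan_atLeast0)

lemma is_abc_sym:
  assumes "is_abc k p" "a < k" "b < k"
  shows "abc_A p $$ (a, b) = abc_A p $$ (b, a)"
  using assms unfolding is_abc_def by (metis carrier_matD index_transpose_mat(1))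

lemma gaussian_fun_derivative:
  assumes p: "is_abc k p" and \<zeta>: "\<zeta> \<in> carrier_vec k" and i: "i < k"
  shows "((\<lambda>t. gaussian_fun p (\<zeta> + t \<cdot>\<^sub>v unit_vec k i)) has_field_derivative
    gaussian_gradient p i \<zeta> * gaussian_fun p \<zeta>) (at 0)"
proof -
  have b: "abc_b p \<in> carrier_vec k"
    using p by (auto simp: is_abc_def)
  let ?l = "\<lambda>t. \<zeta> + t \<cdot>\<^sub>v unit_vec k i"
  have l: "?l t \<in> carrier_vec k" for t using \<zeta> by simp
  note eq = gaussian_fun_eq_sums[OF p]
  have symA: "abc_A p $$ (a, i) = abc_A p $$ (i, a)" if "a < k" for a
    using is_abc_sym[OF p that i] .
  let ?\<delta> = "\<lambda>a. if a = i then 1 else 0 :: complex"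
  have "((\<lambda>t. 1 / 2 * (\<Sum>a<k. \<Sum>b<k. ?l t $ a * abc_A p $$ (a, b) * ?l t $ b) + (\<Sum>a<k. ?l t $ a * abc_b p $ a))
    has_field_derivative
     1 / 2 * (\<Sum>a<k. \<Sum>b<k. ?\<delta> a * abc_A p $$ (a, b) * \<zeta> $ b + \<zeta> $ a * abc_A p $$ (a, b) * ?\<delta> b) + (\<Sum>a<k. ?\<delta> a * abc_b p $ a)) (at 0)"
  proof (intro DERIV_add DERIV_cmult DERIV_sum)
    fix a b assume "a \<in> {..<k}" "b \<in> {..<k}"
    then show "((\<lambda>t. ?l t $ a * abc_A p $$ (a, b) * ?l t $ b) has_field_derivative
      ?\<delta> a * abc_A p $$ (a, b) * \<zeta> $ b + \<zeta> $ a * abc_A p $$ (a, b) * ?\<delta> b) (at 0)"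
      using DERIV_cmult[OF coord_times_has_derivative[OF \<zeta> i _ coord_line_has_derivative[OF \<zeta> i]], of a b "abc_A p $$ (a, b)"]
      by (simp only: lessThan_iff algebra_simps)
  qed (rule DERIV_cmult_right, rule coord_line_has_derivative[OF \<zeta> i], simp)
  \<comment> \<open>The product rule yields row \<open>i\<close> and column \<open>i\<close> of
    \<open>A\<close>; by symmetry they agree, which cancels the factor 1/2.\<close>
  also have "1 / 2 * (\<Sum>a<k. \<Sum>b<k. ?\<delta> a * abc_A p $$ (a, b) * \<zeta> $ b + \<zeta> $ a * abc_A p $$ (a, b) * ?\<delta> b) + (\<Sum>a<k. ?\<delta> a * abc_b p $ a)
    = gaussian_gradient p i \<zeta>"
  proof -
    have "(\<Sum>a<k. \<Sum>b<k. ?\<delta> a * abc_A p $$ (a, b) * \<zeta> $ b) = (\<Sum>a<k. ?\<delta> a * (\<Sum>b<k. abc_A p $$ (a, b) * \<zeta> $ b))"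
      by (simp add: sum_distrib_left mult.assoc)
    also have "\<dots> = (\<Sum>b<k. abc_A p $$ (i, b) * \<zeta> $ b)"
      using i by (simp add: if_distrib[of "\<lambda>x. x * _"] sum.delta cong: if_cong)
    finally have 1: "(\<Sum>a<k. \<Sum>b<k. ?\<delta> a * abc_A p $$ (a, b) * \<zeta> $ b) = (\<Sum>b<k. abc_A p $$ (i, b) * \<zeta> $ b)" .
    have "(\<Sum>a<k. \<Sum>b<k. \<zeta> $ a * abc_A p $$ (a, b) * ?\<delta> b) = (\<Sum>a<k. \<zeta> $ a * abc_A p $$ (a, i))"
      using i by (simp add: if_distrib[of "\<lambda>x. _ * x"] sum.delta cong: if_cong)
    also have "\<dots> = (\<Sum>b<k. abc_A p $$ (i, b) * \<zeta> $ b)"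
      by (intro sum.cong) (auto simp: symA)
    finally have 2: "(\<Sum>a<k. \<Sum>b<k. \<zeta> $ a * abc_A p $$ (a, b) * ?\<delta> b) = (\<Sum>b<k. abc_A p $$ (i, b) * \<zeta> $ b)" .
    have 3: "(\<Sum>a<k. ?\<delta> a * abc_b p $ a) = abc_b p $ i"
      using i by (simp add: if_distrib[of "\<lambda>x. x * _"] sum.delta cong: if_cong)
    show ?thesis
      unfolding sum.distrib 1 2 3 gaussian_gradient_def using b by simp
  qed
  finally have D: "((\<lambda>t. 1 / 2 * (\<Sum>a<k. \<Sum>b<k. ?l t $ a * abc_A p $$ (a, b) * ?l t $ b) + (\<Sum>a<k. ?l t $ a * abc_b p $ a))
    has_field_derivative gaussian_gradient p i \<zeta>) (at 0)" .
  show ?thesis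
    unfolding eq[OF l] eq[OF \<zeta>]
    using DERIV_cmult[OF DERIV_fun_exp[OF D], of "abc_c p"] by (simp only: line_at_0[OF \<zeta>] mult_ac)
qed

text \<open>\<open>P\<close> describes a region containing the whole line through
  \<open>\<zeta>\<close> in direction \<open>i\<close>, so agreement of \<open>F\<close> and
  \<open>H\<close> on that region already determines the derivative.\<close>

lemma partial_deriv_eqI:
  assumes F: "\<And>\<xi>. \<xi> \<in> carrier_vec k \<Longrightarrow> P \<xi> \<Longrightarrow> F \<xi> = H \<xi>" and \<zeta>: "\<zeta> \<in> carrier_vec k"
    and P: "\<And>t. P (\<zeta> + t \<cdot>\<^sub>v unit_vec k i)"
    and D: "((\<lambda>t. H (\<zeta> + t \<cdot>\<^sub>v unit_vec k i)) has_field_derivative y) (at 0)"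
  shows "partial_deriv k i F \<zeta> = y"
proof -
  have "(\<lambda>t. F (\<zeta> + t \<cdot>\<^sub>v unit_vec k i)) = (\<lambda>t. H (\<zeta> + t \<cdot>\<^sub>v unit_vec k i))"
    using \<zeta> P by (intro ext F) auto
  with D show ?thesis by (simp add: partial_deriv_def DERIV_imp_deriv)
qed

text \<open>The gradient is affine in \<open>\<zeta>\<close>, hence raises the degree in the first
  \<open>m\<close> coordinates by at most one.\<close>

lemma graded_poly_times_gradient:
  assumes "is_abc k p" "graded_poly m k d f" "i < k"
  shows "graded_poly m k (Suc d) (\<lambda>\<zeta>. gaussian_gradient p i \<zeta> * f \<zeta>)"
proof -
  have "(\<lambda>\<zeta>. gaussian_gradient p i \<zeta> * f \<zeta>) =
    (\<lambda>\<zeta>. (\<Sum>a<k. abc_A p $$ (i, a) * (\<zeta> $ a * f \<zeta>)) + abc_b p $ i * f \<zeta>)"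
    using assms(1) by (auto simp: gaussian_gradient_def is_abc_def sum_distrib_left algebra_simps)
  then show ?thesis
    using assms graded_poly_Suc[OF assms(2)]
    by (auto intro!: graded_poly.add graded_poly_sum graded_poly.smult graded_poly_times_coord)
qed

definition poly_times_gaussian :: "nat \<Rightarrow> nat \<Rightarrow> nat \<Rightarrow> abc \<Rightarrow> (complex vec \<Rightarrow> complex) \<Rightarrow> bool" where
  "poly_times_gaussian m k d p F \<longleftrightarrow>
     (\<exists>f. graded_poly m k d f \<and> (\<forall>\<zeta>\<in>carrier_vec k. F \<zeta> = f \<zeta> * gaussian_fun p \<zeta>))"

text \<open>The new polynomial factor is the gradient times \<open>f\<close> plus the derivative of
  \<open>f\<close>. Only the first summand can raise the degree in the first \<open>m\<close>
  coordinates, and only by one.\<close>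

lemma poly_times_gaussian_partial_deriv:
  assumes p: "is_abc k p" and F: "poly_times_gaussian m k d p F" and i: "m \<le> i" "i < k"
  shows "poly_times_gaussian m k (Suc d) p (partial_deriv k i F)"
proof -
  obtain f where f: "graded_poly m k d f" "\<And>\<zeta>. \<zeta> \<in> carrier_vec k \<Longrightarrow> F \<zeta> = f \<zeta> * gaussian_fun p \<zeta>"
    using F by (auto simp: poly_times_gaussian_def)
  obtain f' where f': "graded_poly m k d f'"
    "\<And>\<zeta>. \<zeta> \<in> carrier_vec k \<Longrightarrow> ((\<lambda>t. f (\<zeta> + t \<cdot>\<^sub>v unit_vec k i)) has_field_derivative f' \<zeta>) (at 0)"
    using graded_poly_derivative[OF f(1) i(2)] i by auto
  have "partial_deriv k i F \<zeta> = (gaussian_gradient p i \<zeta> * f \<zeta> + f' \<zeta>) * gaussian_fun p \<zeta>"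
    if \<zeta>: "\<zeta> \<in> carrier_vec k" for \<zeta>
  proof (rule partial_deriv_eqI[where P="\<lambda>_. True", OF f(2) \<zeta>])
    show "((\<lambda>t. f (\<zeta> + t \<cdot>\<^sub>v unit_vec k i) * gaussian_fun p (\<zeta> + t \<cdot>\<^sub>v unit_vec k i)) has_field_derivative
      (gaussian_gradient p i \<zeta> * f \<zeta> + f' \<zeta>) * gaussian_fun p \<zeta>) (at 0)"
      using DERIV_mult[OF f'(2)[OF \<zeta>] gaussian_fun_derivative[OF p \<zeta> i(2)]]
      by (simp only: line_at_0[OF \<zeta>] algebra_simps)
  qed auto
  moreover have "graded_poly m k (Suc d) (\<lambda>\<zeta>. gaussian_gradient p i \<zeta> * f \<zeta> + f' \<zeta>)"
    using graded_poly_times_gradient[OF p f(1) i(2)] f'(1) by (intro graded_poly.add) (auto intro: graded_poly_Suc)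
  ultimately show ?thesis unfolding poly_times_gaussian_def by blast
qed

lemma poly_times_gaussian_funpow:
  assumes "is_abc k p" "poly_times_gaussian m k d p F" "m \<le> i" "i < k"
  shows "poly_times_gaussian m k (d + e) p ((partial_deriv k i ^^ e) F)"
  using assms by (induction e) (auto intro: poly_times_gaussian_partial_deriv)

lemma poly_times_gaussian_foldr:
  assumes "is_abc k p" "poly_times_gaussian m k d p F" "\<And>i. i \<in> set is \<Longrightarrow> m \<le> i \<and> i < k"
  shows "poly_times_gaussian m k (d + sum_list (map l is)) p (foldr (\<lambda>i. partial_deriv k i ^^ l i) is F)"
  using assms(3)
proof (induction "is")
  case Nil
  then show ?case using assms(2) by simp
next
  case (Cons i "is")
  then have "poly_times_gaussian m k (d + sum_list (map l is) + l i) p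
    ((partial_deriv k i ^^ l i) (foldr (\<lambda>i. partial_deriv k i ^^ l i) is F))"
    by (intro poly_times_gaussian_funpow[OF assms(1)]) auto
  then show ?case by (simp add: add_ac)
qed

text \<open>
  \<^const>\<open>multi_deriv\<close> applies the derivatives in the last \<open>n\<close> coordinates first. The remaining ones
  only see the slice on which those coordinates vanish, and there the Gaussian factor of a core
  vector is constant, so what is left to differentiate is a polynomial.
\<close>

definition slice_poly :: "nat \<Rightarrow> nat \<Rightarrow> nat \<Rightarrow> (complex vec \<Rightarrow> complex) \<Rightarrow> bool" where
  "slice_poly m k d F \<longleftrightarrow>
     (\<exists>f. graded_poly m k d f \<and> (\<forall>\<zeta>\<in>carrier_vec k. (\<forall>i\<in>{m..<k}. \<zeta> $ i = 0) \<longrightarrow> F \<zeta> = f \<zeta>))"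

text \<open>A line in direction \<open>i < m\<close> never leaves the slice, so only the polynomial
  is differentiated.\<close>

lemma slice_poly_partial_deriv:
  assumes F: "slice_poly m k d F" and i: "i < m" "m \<le> k"
  shows "slice_poly m k (d - 1) (partial_deriv k i F)"
proof -
  obtain f where f: "graded_poly m k d f"
    "\<And>\<zeta>. \<zeta> \<in> carrier_vec k \<Longrightarrow> \<forall>i\<in>{m..<k}. \<zeta> $ i = 0 \<Longrightarrow> F \<zeta> = f \<zeta>"
    using F by (auto simp: slice_poly_def)
  obtain f' where f': "graded_poly m k (d - 1) f'"
    "\<And>\<zeta>. \<zeta> \<in> carrier_vec k \<Longrightarrow> ((\<lambda>t. f (\<zeta> + t \<cdot>\<^sub>v unit_vec k i)) has_field_derivative f' \<zeta>) (at 0)"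
    using graded_poly_derivative[OF f(1), of i] i by auto
  have "partial_deriv k i F \<zeta> = f' \<zeta>"
    if \<zeta>: "\<zeta> \<in> carrier_vec k" and 0: "\<forall>i\<in>{m..<k}. \<zeta> $ i = 0" for \<zeta>
    using \<zeta> 0 i
    by (intro partial_deriv_eqI[where P="\<lambda>\<zeta>. \<forall>i\<in>{m..<k}. \<zeta> $ i = 0", OF f(2) \<zeta> _ f'(2)[OF \<zeta>]]) auto
  with f'(1) show ?thesis unfolding slice_poly_def by blast
qed

lemma slice_poly_funpow:
  assumes "slice_poly m k d F" "i < m" "m \<le> k"
  shows "slice_poly m k (d - e) ((partial_deriv k i ^^ e) F)"
proof (induction e)
  case (Suc e)
  then show ?case using slice_poly_partial_deriv[OF _ assms(2,3)] by fastforce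
qed (use assms in simp)

lemma slice_poly_foldr:
  assumes "slice_poly m k d F" "\<And>i. i \<in> set is \<Longrightarrow> i < m" "m \<le> k"
  shows "slice_poly m k (d - sum_list (map l is)) (foldr (\<lambda>i. partial_deriv k i ^^ l i) is F)"
  using assms(2)
proof (induction "is")
  case Nil
  then show ?case using assms(1) by simp
next
  case (Cons i "is")
  then have "slice_poly m k (d - sum_list (map l is) - l i)
    ((partial_deriv k i ^^ l i) (foldr (\<lambda>i. partial_deriv k i ^^ l i) is F))"
    by (intro slice_poly_funpow assms(3)) auto
  then show ?case by (simp add: diff_diff_left add_ac)
qed

text \<open>Every term of the exponent contains either a coordinate that is zero on the slice or an
  entry of \<open>A\<close> or \<open>b\<close> assumed to vanish.\<close>

lemma gaussian_fun_const_on_slice: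
  assumes p: "is_abc k p" and mk: "m \<le> k"
    and A: "\<And>i j. i < m \<Longrightarrow> j < m \<Longrightarrow> abc_A p $$ (i, j) = 0" and b: "\<And>i. i < m \<Longrightarrow> abc_b p $ i = 0"
    and \<zeta>: "\<zeta> \<in> carrier_vec k" "\<forall>i\<in>{m..<k}. \<zeta> $ i = 0"
  shows "gaussian_fun p \<zeta> = abc_c p"
proof -
  have z: "\<zeta> $ i = 0" if "i < k" "\<not> i < m" for i using \<zeta>(2) that by auto
  have "(\<Sum>i<k. \<Sum>j<k. \<zeta> $ i * abc_A p $$ (i, j) * \<zeta> $ j) = 0"
  proof (intro sum.neutral ballI)
    fix i j assume "i \<in> {..<k}" "j \<in> {..<k}"
    then show "\<zeta> $ i * abc_A p $$ (i, j) * \<zeta> $ j = 0"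
      using A[of i j] z[of i] z[of j] by (cases "i < m"; cases "j < m") auto
  qed
  moreover have "(\<Sum>i = 0..<k. \<zeta> $ i * abc_b p $ i) = 0"
  proof (intro sum.neutral ballI)
    fix i assume "i \<in> {0..<k}"
    then show "\<zeta> $ i * abc_b p $ i = 0"
      using b[of i] z[of i] by (cases "i < m") auto
  qed
  ultimately show ?thesis
    using p \<zeta>(1) by (auto simp: gaussian_fun_def quadratic_form_sum[where k=k] is_abc_def scalar_prod_def[of \<zeta> "abc_b p"])
qed

text \<open>If \<open>r\<close> derivatives are taken in the last \<open>n\<close> coordinates, they
  leave on the slice a polynomial of degree at most \<open>r\<close> in the first \<open>m\<close>;
  more than \<open>r\<close> derivatives in these annihilate it.\<close>

lemma fock_coeff_eq_0:
  assumes p: "has_abc (m + n) F p"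
    and A: "\<And>i j. i < m \<Longrightarrow> j < m \<Longrightarrow> abc_A p $$ (i, j) = 0" and b: "\<And>i. i < m \<Longrightarrow> abc_b p $ i = 0"
    and l: "(\<Sum>i\<in>{m..<m + n}. l $ i) < (\<Sum>i<m. l $ i)"
  shows "fock_coeff (m + n) F l = 0"
proof -
  let ?k = "m + n" and ?D = "\<lambda>i. partial_deriv (m + n) i ^^ (l $ i)"
  have abc: "is_abc ?k p" and F: "\<forall>\<zeta>\<in>carrier_vec ?k. F \<zeta> = gaussian_fun p \<zeta>"
    using p by (auto simp: has_abc_def)
  have split: "[0..<?k] = [0..<m] @ [m..<?k]" using upt_add_eq_append[of 0 m n] by simp
  have sums: "sum_list (map (($) l) [a..<c]) = (\<Sum>i\<in>{a..<c}. l $ i)" for a c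
    by (simp add: sum_list_distinct_conv_sum_set)
  \<comment> \<open>The start is the constant polynomial 1, whose index is \<open>Suc 0\<close>
    because the degree bound is strict.\<close>
  have "poly_times_gaussian m ?k (Suc 0) p F"
    unfolding poly_times_gaussian_def using F by (intro exI[of _ "\<lambda>_. 1"]) (auto intro: graded_poly.const)
  from poly_times_gaussian_foldr[OF abc this, of "[m..<?k]" "($) l"]
  have "poly_times_gaussian m ?k (Suc (\<Sum>i\<in>{m..<m + n}. l $ i)) p (foldr ?D [m..<?k] F)"
    by (simp add: sums)
  then obtain f where f: "graded_poly m ?k (Suc (\<Sum>i\<in>{m..<m + n}. l $ i)) f"
    "\<And>\<zeta>. \<zeta> \<in> carrier_vec ?k \<Longrightarrow> foldr ?D [m..<?k] F \<zeta> = f \<zeta> * gaussian_fun p \<zeta>"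
    by (auto simp: poly_times_gaussian_def)
  have "slice_poly m ?k (Suc (\<Sum>i\<in>{m..<m + n}. l $ i)) (foldr ?D [m..<?k] F)"
    unfolding slice_poly_def
  proof (intro exI conjI ballI impI)
    show "graded_poly m ?k (Suc (\<Sum>i\<in>{m..<m + n}. l $ i)) (\<lambda>\<zeta>. abc_c p * f \<zeta>)"
      using f(1) by (rule graded_poly.smult)
    show "foldr ?D [m..<?k] F \<zeta> = abc_c p * f \<zeta>"
      if "\<zeta> \<in> carrier_vec ?k" "\<forall>i\<in>{m..<?k}. \<zeta> $ i = 0" for \<zeta>
      using f(2)[OF that(1)] gaussian_fun_const_on_slice[OF abc _ A b that] by simp
  qed
  \<comment> \<open>By \<open>l\<close> the truncated difference of the degree bound and the number
    of derivatives is 0, and index 0 contains only the zero polynomial.\<close>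
  from slice_poly_foldr[OF this, of "[0..<m]" "($) l"] l
  have "slice_poly m ?k 0 (multi_deriv ?k l F)"
    by (simp add: sums multi_deriv_def split atLeast0LessThan del: upt_Suc)
  then have "multi_deriv ?k l F (0\<^sub>v ?k) = 0"
    by (auto simp: slice_poly_def dest: graded_poly_0)
  then show ?thesis by (simp add: fock_coeff_def)
qed

section \<open>Finiteness of the Fock support\<close>

lemma finite_bounded_nat_vecs: "finite {j \<in> carrier_vec m. \<forall>i<m. (j $ i :: nat) \<le> B}"
proof (rule finite_subset)
  show "{j \<in> carrier_vec m. \<forall>i<m. (j $ i :: nat) \<le> B} \<subseteq> vec_of_list ` {xs. set xs \<subseteq> {..B} \<and> length xs = m}"
  proof
    fix j assume j: "j \<in> {j \<in> carrier_vec m. \<forall>i<m. (j $ i :: nat) \<le> B}"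
    then show "j \<in> vec_of_list ` {xs. set xs \<subseteq> {..B} \<and> length xs = m}"
      by (intro image_eqI[of _ _ "list_of_vec j"]) (auto simp: vec_list set_list_of_vec vec_set_def)
  qed
qed (simp add: finite_lists_length_eq)

text \<open>A nonzero coefficient forces the entries of \<open>j\<close> to sum to at most the sum
  of the entries of \<open>k\<close>, so \<open>j\<close> lies in a finite box.\<close>

lemma gaussian_core_vectorI:
  assumes p: "has_abc (m + n) F p"
    and A: "\<And>i j. i < m \<Longrightarrow> j < m \<Longrightarrow> abc_A p $$ (i, j) = 0" and b: "\<And>i. i < m \<Longrightarrow> abc_b p $ i = 0"
  shows "gaussian_core_vector m n F"
  unfolding gaussian_core_vector_def
proof (intro conjI ballI)
  show "gaussian_vector (m + n) F" using p by (auto simp: gaussian_vector_def)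
  fix k :: "nat vec" assume k: "k \<in> carrier_vec n"
  show "finite {j \<in> carrier_vec m. fock_coeff (m + n) F (j @\<^sub>v k) \<noteq> 0}"
  proof (rule finite_subset[OF _ finite_bounded_nat_vecs[of m "\<Sum>i<n. k $ i"]], safe)
    fix j :: "nat vec" and i assume j: "j \<in> carrier_vec m" and nz: "fock_coeff (m + n) F (j @\<^sub>v k) \<noteq> 0" and i: "i < m"
    have "(\<Sum>i\<in>{m..<m + n}. (j @\<^sub>v k) $ i) = (\<Sum>i<n. k $ i)"
      using j k by (intro sum.reindex_bij_witness[of _ "\<lambda>i. i + m" "\<lambda>i. i - m"]) auto
    moreover have "(\<Sum>i<m. (j @\<^sub>v k) $ i) = (\<Sum>i<m. j $ i)"
      using j k by (intro sum.cong) auto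
    ultimately have "(\<Sum>i<m. j $ i) \<le> (\<Sum>i<n. k $ i)"
      using fock_coeff_eq_0[OF p A b, of "j @\<^sub>v k"] nz by force
    moreover have "j $ i \<le> (\<Sum>i<m. j $ i)" using i by (intro member_le_sum) auto
    ultimately show "j $ i \<le> (\<Sum>i<n. k $ i)" by simp
  qed
qed

section \<open>The program\<close>

lemma halts_within_mono:
  "halts_within P s N post \<Longrightarrow> N \<le> N' \<Longrightarrow> (\<And>s'. post s' \<Longrightarrow> post' s') \<Longrightarrow> halts_within P s N' post'"
  unfolding halts_within_def by (meson le_trans)

text \<open>The bound \<open>Suc N\<close> accepts any positive budget, so branches of different
  length can share one bound.\<close>

lemma halts_within_SetReg: "post (set_reg x (ival s e) s) \<Longrightarrow> halts_within (PSetReg x e) s (Suc N) post"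
  unfolding halts_within_def by (intro exI conjI, rule exec.SetReg) auto

lemma halts_within_SetCell:
  "post (set_cell X (ival s e) (ival s f) (cval s a) s) \<Longrightarrow> halts_within (PSetCell X e f a) s (Suc N) post"
  unfolding halts_within_def by (intro exI conjI, rule exec.SetCell) auto

text \<open>In the style of weakest preconditions, the claim about \<open>Q\<close> is the
  postcondition of \<open>P\<close>.\<close>

lemma halts_within_Seq:
  assumes "halts_within P s N (\<lambda>s'. halts_within Q s' N' post)"
  shows "halts_within (PSeq P Q) s (N + N') post"
  using assms unfolding halts_within_def by (meson exec.Seq add_mono)

lemma halts_within_If:
  assumes "tval s b \<Longrightarrow> halts_within P s N post" "\<not> tval s b \<Longrightarrow> halts_within Q s N post"
  shows "halts_within (PIf b P Q) s (Suc N) post"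
proof (cases "tval s b")
  case True
  with assms obtain t s' where "exec P s t s'" "t \<le> N" "post s'" by (auto simp: halts_within_def)
  with True show ?thesis
    unfolding halts_within_def by (intro exI[of _ "1 + t"] exI[of _ s']) (auto intro: exec.IfTrue[simplified])
next
  case False
  with assms obtain t s' where "exec Q s t s'" "t \<le> N" "post s'" by (auto simp: halts_within_def)
  with False show ?thesis
    unfolding halts_within_def by (intro exI[of _ "1 + t"] exI[of _ s']) (auto intro: exec.IfFalse[simplified])
qed

text \<open>The invariant is indexed by the number \<open>a\<close> of completed rounds. A round
  costs \<open>N\<close> for the body and 1 for the test; the final 1 is the failing test. The
  induction is on the number of rounds left.\<close>

lemma halts_within_While:
  assumes guard: "\<And>a s. a \<le> M \<Longrightarrow> I a s \<Longrightarrow> tval s b \<longleftrightarrow> a < M"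
    and step: "\<And>a s. a < M \<Longrightarrow> I a s \<Longrightarrow> halts_within P s N (I (Suc a))"
    and "a \<le> M" "I a s"
  shows "halts_within (PWhile b P) s ((M - a) * Suc N + 1) (I M)"
  using \<open>a \<le> M\<close> \<open>I a s\<close>
proof (induction "M - a" arbitrary: a s)
  case 0
  then show ?case
    using guard[of a s] exec.WhileFalse[of s b P]
    unfolding halts_within_def by (intro exI[of _ 1] exI[of _ s]) auto
next
  case (Suc r)
  then have a: "a < M" by simp
  obtain t s' where t: "exec P s t s'" "t \<le> N" "I (Suc a) s'"
    using step[OF a Suc.prems(2)] by (auto simp: halts_within_def)
  have "halts_within (PWhile b P) s' ((M - Suc a) * Suc N + 1) (I M)"
    using Suc.hyps(2) a t(3) by (intro Suc.hyps(1)) auto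
  then obtain u s'' where u: "exec (PWhile b P) s' u s''" "u \<le> (M - Suc a) * Suc N + 1" "I M s''"
    by (auto simp: halts_within_def)
  have "exec (PWhile b P) s (1 + t + u) s''"
    using guard[of a s] a Suc.prems t(1) u(1) by (intro exec.WhileTrue) auto
  moreover have "M - a = Suc (M - Suc a)" using a by simp
  then have "1 + t + u \<le> (M - a) * Suc N + 1" using t(2) u(2) by simp
  ultimately show ?case using u(3) unfolding halts_within_def by blast
qed

section \<open>Counting loops and array filling\<close>

definition for_loop :: "string \<Rightarrow> iexp \<Rightarrow> prog \<Rightarrow> prog" where
  "for_loop x e P = PSeq (PSetReg x (ILit 0))
     (PWhile (TLess (IReg x) e) (PSeq P (PSetReg x (IPlus (IReg x) (ILit 1)))))"

text \<open>Each round costs \<open>N\<close> plus the increment and the test; the extra 2 are the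
  initialisation and the failing test. By \<open>inv\<close> the invariant must fix both the counter
  and the value of the limit.\<close>

lemma halts_within_for_loop:
  assumes init: "I 0 (set_reg x 0 s)"
    and inv: "\<And>a s. a \<le> M \<Longrightarrow> I a s \<Longrightarrow> reg s x = a \<and> ival s e = M"
    and step: "\<And>a s. a < M \<Longrightarrow> I a s \<Longrightarrow> halts_within P s N (\<lambda>s'. I (Suc a) (set_reg x (Suc (reg s' x)) s'))"
  shows "halts_within (for_loop x e P) s (M * (N + 2) + 2) (I M)"
proof -
  let ?body = "PSeq P (PSetReg x (IPlus (IReg x) (ILit 1)))"
  have "halts_within (PWhile (TLess (IReg x) e) ?body) (set_reg x 0 s) ((M - 0) * Suc (N + 1) + 1) (I M)"
  proof (rule halts_within_While)
    show "halts_within ?body s (N + 1) (I (Suc a))" if "a < M" "I a s" for a s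
      by (rule halts_within_Seq halts_within_mono[OF step[OF that]])+ (auto intro: halts_within_SetReg)
  qed (use init inv in auto)
  then have "halts_within (for_loop x e P) s (Suc 0 + ((M - 0) * Suc (N + 1) + 1)) (I M)"
    unfolding for_loop_def by (intro halts_within_Seq halts_within_SetReg) simp
  then show ?thesis by (rule halts_within_mono) auto
qed

text \<open>\<open>Q\<close> is an entrywise program that reads its index from the loop counters, so
  the same code answers single requests and fills whole arrays. Vectors and scalars are arrays with
  one column.\<close>

definition fill :: "string \<Rightarrow> iexp \<Rightarrow> iexp \<Rightarrow> prog \<Rightarrow> prog" where
  "fill X r c Q = for_loop ''i'' r (for_loop ''j'' c
     (PSeq Q (PSetCell X (IReg ''i'') (IReg ''j'') (CCell ''out'' (ILit 0) (ILit 0)))))"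

definition array_eq :: "string \<Rightarrow> nat \<Rightarrow> nat \<Rightarrow> (nat \<Rightarrow> nat \<Rightarrow> complex) \<Rightarrow> store \<Rightarrow> bool" where
  "array_eq X R C f s \<longleftrightarrow> (\<forall>i<R. \<forall>j<C. cell s X i j = f i j)"

lemma store_simps [simp]:
  "reg (set_reg x a s) = (reg s)(x := a)"
  "cell (set_reg x a s) = cell s"
  "reg (set_cell X i j v s) = reg s"
  "cell (set_cell X i j v s) = (cell s)(X := (cell s X)(i := (cell s X i)(j := v)))"
  by (simp_all add: set_reg_def set_cell_def)

text \<open>The final store is prescribed completely: only the output cell changes, so loop counters
  and arrays filled earlier survive a call of \<open>Q\<close>.\<close>

definition computes_entry :: "(store \<Rightarrow> bool) \<Rightarrow> nat \<Rightarrow> nat \<Rightarrow> (nat \<Rightarrow> nat \<Rightarrow> complex) \<Rightarrow> nat \<Rightarrow> prog \<Rightarrow> bool" where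
  "computes_entry J R C f N Q \<longleftrightarrow>
     (\<forall>s. J s \<longrightarrow> reg s ''i'' < R \<longrightarrow> reg s ''j'' < C \<longrightarrow>
        halts_within Q s N (\<lambda>s'. s' = set_cell ''out'' 0 0 (f (reg s ''i'') (reg s ''j'')) s))"

text \<open>\<open>J\<close> stands for the input and the arrays already filled; stability under the
  writes made here lets several fills be chained. An entry costs \<open>N + 3\<close>:
  \<open>Q\<close>, the copy, the increment and the test. A row adds 2 for each of the two
  loops.\<close>

lemma halts_within_fill:
  assumes J_reg: "\<And>s x a. J s \<Longrightarrow> x \<in> {''i'', ''j''} \<Longrightarrow> J (set_reg x a s)"
    and J_cell: "\<And>s Y i j v. J s \<Longrightarrow> Y \<in> {X, ''out''} \<Longrightarrow> J (set_cell Y i j v s)"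
    and bounds: "\<And>s. J s \<Longrightarrow> ival s r = R \<and> ival s c = C"
    and Q: "computes_entry J R C f N Q"
    and X: "X \<noteq> ''out''" and s: "J s"
  shows "halts_within (fill X r c Q) s (R * (C * (N + 3) + 4) + 2) (\<lambda>s'. J s' \<and> array_eq X R C f s')"
proof -
  let ?cell = "PSetCell X (IReg ''i'') (IReg ''j'') (CCell ''out'' (ILit 0) (ILit 0))"
  \<comment> \<open>\<open>Iout\<close> says that the rows before \<open>a\<close> are complete,
    \<open>Iin\<close> that in addition the first \<open>b\<close> entries of row \<open>a\<close>
    are.\<close>
  define Iout where "Iout a s \<longleftrightarrow> J s \<and> reg s ''i'' = a \<and> array_eq X a C f s" for a s
  define Iin where "Iin a b s \<longleftrightarrow> Iout a s \<and> reg s ''j'' = b \<and> (\<forall>j<b. cell s X a j = f a j)" for a b s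
  have body: "halts_within (PSeq Q ?cell) s (N + 1) (\<lambda>s'. Iin a (Suc b) (set_reg ''j'' (Suc (reg s' ''j'')) s'))"
    if a: "a < R" and b: "b < C" and I: "Iin a b s" for a b s
  proof (rule halts_within_Seq, rule halts_within_mono[OF _ order_refl])
    show "halts_within Q s N (\<lambda>s'. s' = set_cell ''out'' 0 0 (f a b) s)"
      using Q a b I by (auto simp: computes_entry_def Iin_def Iout_def)
    fix s' assume "s' = set_cell ''out'' 0 0 (f a b) s"
    then show "halts_within ?cell s' 1 (\<lambda>s'. Iin a (Suc b) (set_reg ''j'' (Suc (reg s' ''j'')) s'))"
      unfolding One_nat_def using I X
      by (intro halts_within_SetCell) (auto simp: Iin_def Iout_def array_eq_def less_Suc_eq J_reg J_cell)
  qed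
  have inner: "halts_within (for_loop ''j'' c (PSeq Q ?cell)) s (C * (N + 1 + 2) + 2) (Iin a C)"
    if a: "a < R" and I: "Iout a s" for a s
  proof (rule halts_within_for_loop)
    show "halts_within (PSeq Q ?cell) s (N + 1) (\<lambda>s'. Iin a (Suc b) (set_reg ''j'' (Suc (reg s' ''j'')) s'))"
      if "b < C" "Iin a b s" for b s
      by (rule body[OF a that])
  qed (use I in \<open>auto simp: Iin_def Iout_def array_eq_def J_reg bounds\<close>)
  have "halts_within (fill X r c Q) s (R * (C * (N + 1 + 2) + 2 + 2) + 2) (Iout R)"
    unfolding fill_def
  proof (rule halts_within_for_loop)
    show "halts_within (for_loop ''j'' c (PSeq Q ?cell)) s (C * (N + 1 + 2) + 2)
        (\<lambda>s'. Iout (Suc a) (set_reg ''i'' (Suc (reg s' ''i'')) s'))" if "a < R" "Iout a s" for a s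
      by (rule halts_within_mono[OF inner[OF that] order_refl])
        (auto simp: Iin_def Iout_def array_eq_def less_Suc_eq J_reg)
  qed (use s in \<open>auto simp: Iout_def array_eq_def J_reg bounds\<close>)
  then show ?thesis by (rule halts_within_mono) (auto simp: Iout_def algebra_simps)
qed

section \<open>The two parametrizations and their entry programs\<close>

abbreviation out :: "cexp \<Rightarrow> prog" where
  "out \<equiv> PSetCell ''out'' (ILit 0) (ILit 0)"

abbreviation in_M :: "string \<Rightarrow> test" where
  "in_M x \<equiv> TLess (IReg x) (IReg ''m'')"

text \<open>The test \<open>y = x + m\<close>; the machine compares indices by \<open><\<close> only.\<close>

abbreviation partner :: "string \<Rightarrow> string \<Rightarrow> test" where
  "partner x y \<equiv> TAnd (TNot (TLess (IReg y) (IPlus (IReg x) (IReg ''m''))))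
     (TNot (TLess (IPlus (IReg x) (IReg ''m'')) (IReg y)))"

definition entry_A_S where
  "entry_A_S = PIf (TAnd (in_M ''i'') (in_M ''j'')) (out CZero) (out (CCell ''A'' (IReg ''i'') (IReg ''j'')))"

definition entry_b_S where
  "entry_b_S = PIf (in_M ''i'') (out CZero) (out (CCell ''b'' (IReg ''i'') (ILit 0)))"

definition entry_A_T where
  "entry_A_T = PIf (TAnd (in_M ''i'') (in_M ''j'')) (out (CCell ''A'' (IReg ''i'') (IReg ''j'')))
     (PIf (partner ''i'' ''j'') (out COne) (PIf (partner ''j'' ''i'') (out COne) (out CZero)))"

definition entry_b_T where
  "entry_b_T = PIf (in_M ''i'') (out (CCell ''b'' (IReg ''i'') (ILit 0))) (out CZero)"

text \<open>The exponent \<open>w^T B v + r(v)\<close>: the part of \<open>G\<close> quadratic or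
  linear in the \<open>M\<close> variables alone is erased.\<close>

definition core_abc :: "nat \<Rightarrow> nat \<Rightarrow> abc \<Rightarrow> abc" where
  "core_abc m n p = \<lparr>
     abc_A = Matrix.mat (m + n) (m + n) (\<lambda>(i, j). if i < m \<and> j < m then 0 else abc_A p $$ (i, j)),
     abc_b = Matrix.vec (m + n) (\<lambda>i. if i < m then 0 else abc_b p $ i),
     abc_c = abc_c p\<rparr>"

text \<open>The exponent \<open>q(z) + z^T w\<close>, with identity blocks off the diagonal pairing
  outputs with inputs. The scalar is 1 because the core vector carries that of
  \<open>G\<close>.\<close>

definition op_abc :: "nat \<Rightarrow> abc \<Rightarrow> abc" where
  "op_abc m p = \<lparr>
     abc_A = Matrix.mat (2 * m) (2 * m) (\<lambda>(i, j). if i < m \<and> j < m then abc_A p $$ (i, j)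
       else if j = i + m \<or> i = j + m then 1 else 0),
     abc_b = Matrix.vec (2 * m) (\<lambda>i. if i < m then abc_b p $ i else 0),
     abc_c = 1\<rparr>"

lemma input_store_set_reg [simp]:
  "x \<noteq> ''m'' \<Longrightarrow> x \<noteq> ''n'' \<Longrightarrow> input_store m n p (set_reg x a s) = input_store m n p s"
  by (simp add: input_store_def stores_abc_def)

lemma input_store_set_cell [simp]:
  "X \<noteq> ''A'' \<Longrightarrow> X \<noteq> ''b'' \<Longrightarrow> X \<noteq> ''c'' \<Longrightarrow> input_store m n p (set_cell X i j v s) = input_store m n p s"
  by (simp add: input_store_def stores_abc_def)

lemma array_eq_set_reg [simp]: "array_eq X R C f (set_reg x a s) = array_eq X R C f s"
  by (simp add: array_eq_def)

lemma array_eq_set_cell [simp]: "X \<noteq> Y \<Longrightarrow> array_eq X R C f (set_cell Y i j v s) = array_eq X R C f s"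
  by (simp add: array_eq_def)

text \<open>Four steps are the worst case, three nested tests and an assignment in
  \<open>entry_A_T\<close>; the \<open>Suc\<close> form matches the program rules.\<close>

lemma four_eq_Suc: "(4 :: nat) = Suc (Suc (Suc (Suc 0)))"
  by simp

text \<open>\<open>J\<close> may be stronger than \<open>input_store\<close>, so the facts apply at
  every stage of the full program.\<close>

lemma computes_entry_core:
  assumes J: "\<And>s. J s \<Longrightarrow> input_store m n p s"
  shows "computes_entry J (m + n) (m + n) (\<lambda>i j. abc_A (core_abc m n p) $$ (i, j)) 4 entry_A_S"
    and "computes_entry J (m + n) C (\<lambda>i j. abc_b (core_abc m n p) $ i) 4 entry_b_S"
    and "computes_entry J R C (\<lambda>i j. abc_c (core_abc m n p)) 4 (out (CCell ''c'' (ILit 0) (ILit 0)))"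
  unfolding computes_entry_def entry_A_S_def entry_b_S_def four_eq_Suc
  by (intro allI impI halts_within_If halts_within_SetCell;
      auto dest!: J simp: core_abc_def input_store_def stores_abc_def)+

lemma computes_entry_op:
  assumes J: "\<And>s. J s \<Longrightarrow> input_store m n p s"
  shows "computes_entry J (2 * m) (2 * m) (\<lambda>i j. abc_A (op_abc m p) $$ (i, j)) 4 entry_A_T"
    and "computes_entry J (2 * m) C (\<lambda>i j. abc_b (op_abc m p) $ i) 4 entry_b_T"
    and "computes_entry J R C (\<lambda>i j. abc_c (op_abc m p)) 4 (out COne)"
  unfolding computes_entry_def entry_A_T_def entry_b_T_def four_eq_Suc
  by (intro allI impI halts_within_If halts_within_SetCell;
      auto dest!: J simp: op_abc_def input_store_def stores_abc_def)+

lemma computes_Ab_entriesI: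
  assumes A: "computes_entry (input_store m n p) k k (\<lambda>i j. abc_A q $$ (i, j)) N QA"
    and b: "\<And>C. computes_entry (input_store m n p) k C (\<lambda>i j. abc_b q $ i) N Qb"
  shows "computes_Ab_entries QA Qb N m n p k q"
  unfolding computes_Ab_entries_def
proof (intro conjI allI impI; elim conjE)
  fix s i j assume "input_store m n p s" "reg s ''i'' = i" "reg s ''j'' = j" "i < k" "j < k"
  then have "halts_within QA s N (\<lambda>s'. s' = set_cell ''out'' 0 0 (abc_A q $$ (i, j)) s)"
    using A unfolding computes_entry_def by blast
  then show "halts_within QA s N (\<lambda>s'. cell s' ''out'' 0 0 = abc_A q $$ (i, j))"
    by (rule halts_within_mono) auto
next
  fix s i assume "input_store m n p s" "reg s ''i'' = i" "i < k"
  then have "halts_within Qb s N (\<lambda>s'. s' = set_cell ''out'' 0 0 (abc_b q $ i) s)"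
    \<comment> \<open>A request for a vector entry leaves register \<open>j\<close> arbitrary, so
      the column bound is taken just above its content.\<close>
    using b[of "Suc (reg s ''j'')"] unfolding computes_entry_def by blast
  then show "halts_within Qb s N (\<lambda>s'. cell s' ''out'' 0 0 = abc_b q $ i)"
    by (rule halts_within_mono) auto
qed

section \<open>The full program and its quadratic running time\<close>

definition decomposition_prog :: prog where
  "decomposition_prog =
    (let k = IPlus (IReg ''m'') (IReg ''n''); l = IPlus (IReg ''m'') (IReg ''m''); u = ILit 1 in
     PSeq (fill ''A_S'' k k entry_A_S) (PSeq (fill ''b_S'' k u entry_b_S)
      (PSeq (fill ''c_S'' u u (out (CCell ''c'' (ILit 0) (ILit 0))))
       (PSeq (fill ''A_T'' l l entry_A_T) (PSeq (fill ''b_T'' l u entry_b_T) (fill ''c_T'' u u (out COne)))))))"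

text \<open>One bound for all six arrays, to be used with \<open>k = m + n\<close>:
  \<open>2 * k + 1\<close> dominates \<open>m + n\<close>, \<open>2 * m\<close> and 1, also for
  \<open>k = 0\<close>. The linear term is absorbed by \<open>k \<le> k^2\<close>.\<close>

lemma halts_within_fill_quadratic:
  assumes "\<And>s x a. J s \<Longrightarrow> x \<in> {''i'', ''j''} \<Longrightarrow> J (set_reg x a s)"
    and "\<And>s Y i j v. J s \<Longrightarrow> Y \<in> {X, ''out''} \<Longrightarrow> J (set_cell Y i j v s)"
    and "\<And>s. J s \<Longrightarrow> ival s r = R \<and> ival s c = C"
    and "computes_entry J R C f 4 Q"
    and "X \<noteq> ''out''" and "J s" and R: "R \<le> 2 * k + 1" and C: "C \<le> 2 * k + 1"
    and post: "\<And>s. J s \<Longrightarrow> array_eq X R C f s \<Longrightarrow> post s"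
  shows "halts_within (fill X r c Q) s (80 * (k\<^sup>2 + 1)) post"
proof (rule halts_within_mono[OF halts_within_fill[OF assms(1-6)]])
  have "R * (C * (4 + 3) + 4) + 2 \<le> (2 * k + 1) * ((2 * k + 1) * 7 + 4) + 2"
    using R C by (intro add_mono mult_mono) auto
  also have "\<dots> \<le> 80 * (k\<^sup>2 + 1)"
  proof -
    have "(2 * k + 1) * ((2 * k + 1) * 7 + 4) + 2 = 28 * k\<^sup>2 + 36 * k + 13"
      by (simp add: power2_eq_square algebra_simps)
    moreover have "k \<le> k\<^sup>2" by (simp add: power2_eq_square)
    moreover have "80 * (k\<^sup>2 + 1) = 28 * k\<^sup>2 + 36 * k\<^sup>2 + 16 * k\<^sup>2 + 80" by simp
    ultimately show ?thesis by simp
  qed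
  finally show "R * (C * (4 + 3) + 4) + 2 \<le> 80 * (k\<^sup>2 + 1)" .
qed (use post in auto)

lemma stores_abcI:
  assumes "array_eq X k k (\<lambda>i j. abc_A q $$ (i, j)) s" "array_eq Y k 1 (\<lambda>i j. abc_b q $ i) s"
    and "array_eq Z 1 1 (\<lambda>i j. abc_c q) s"
  shows "stores_abc X Y Z k q s"
  using assms by (simp add: array_eq_def stores_abc_def)

text \<open>The constant 480 is six fills at 80 each.\<close>

lemma decomposition_prog_correct:
  "computes_decomposition decomposition_prog (480 * ((m + n)\<^sup>2 + 1)) m n p (core_abc m n p) (op_abc m p)"
  unfolding computes_decomposition_def
proof (intro allI impI)
  fix s assume s: "input_store m n p s"
  define N where "N = 80 * ((m + n)\<^sup>2 + 1)"
  define J0 where "J0 = input_store m n p"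
  \<comment> \<open>Each predicate adds the array just filled; the later fills write to arrays with
    other names and preserve it.\<close>
  define J1 where "J1 s \<longleftrightarrow> J0 s \<and> array_eq ''A_S'' (m + n) (m + n) (\<lambda>i j. abc_A (core_abc m n p) $$ (i, j)) s" for s
  define J2 where "J2 s \<longleftrightarrow> J1 s \<and> array_eq ''b_S'' (m + n) 1 (\<lambda>i j. abc_b (core_abc m n p) $ i) s" for s
  define J3 where "J3 s \<longleftrightarrow> J2 s \<and> array_eq ''c_S'' 1 1 (\<lambda>i j. abc_c (core_abc m n p)) s" for s
  define J4 where "J4 s \<longleftrightarrow> J3 s \<and> array_eq ''A_T'' (2 * m) (2 * m) (\<lambda>i j. abc_A (op_abc m p) $$ (i, j)) s" for s
  define J5 where "J5 s \<longleftrightarrow> J4 s \<and> array_eq ''b_T'' (2 * m) 1 (\<lambda>i j. abc_b (op_abc m p) $ i) s" for s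
  define J6 where "J6 s \<longleftrightarrow> J5 s \<and> array_eq ''c_T'' 1 1 (\<lambda>i j. abc_c (op_abc m p)) s" for s
  note J_defs = J6_def J5_def J4_def J3_def J2_def J1_def J0_def
  let ?k = "IPlus (IReg ''m'') (IReg ''n'')" and ?l = "IPlus (IReg ''m'') (IReg ''m'')" and ?u = "ILit 1"
  have ival: "reg s ''m'' = m" "reg s ''n'' = n" if "input_store m n p s" for s
    using that by (auto simp: input_store_def)
  have 1: "halts_within (fill ''A_S'' ?k ?k entry_A_S) s N J1" if "J0 s" for s
    unfolding N_def by (rule halts_within_fill_quadratic[where J=J0, OF _ _ _ computes_entry_core(1)[where m=m and n=n and p=p]])
      (use that in \<open>auto simp: ival J_defs\<close>)
  have 2: "halts_within (fill ''b_S'' ?k ?u entry_b_S) s N J2" if "J1 s" for s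
    unfolding N_def by (rule halts_within_fill_quadratic[where J=J1, OF _ _ _ computes_entry_core(2)[where m=m and n=n and p=p and C=1]])
      (use that in \<open>auto simp: ival J_defs\<close>)
  have 3: "halts_within (fill ''c_S'' ?u ?u (out (CCell ''c'' (ILit 0) (ILit 0)))) s N J3" if "J2 s" for s
    unfolding N_def by (rule halts_within_fill_quadratic[where J=J2, OF _ _ _ computes_entry_core(3)[where m=m and n=n and p=p and R=1 and C=1]])
      (use that in \<open>auto simp: ival J_defs\<close>)
  have 4: "halts_within (fill ''A_T'' ?l ?l entry_A_T) s N J4" if "J3 s" for s
    unfolding N_def by (rule halts_within_fill_quadratic[where J=J3, OF _ _ _ computes_entry_op(1)[where m=m and n=n and p=p]])
      (use that in \<open>auto simp: ival J_defs\<close>)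
  have 5: "halts_within (fill ''b_T'' ?l ?u entry_b_T) s N J5" if "J4 s" for s
    unfolding N_def by (rule halts_within_fill_quadratic[where J=J4, OF _ _ _ computes_entry_op(2)[where m=m and n=n and p=p and C=1]])
      (use that in \<open>auto simp: ival J_defs\<close>)
  have 6: "halts_within (fill ''c_T'' ?u ?u (out COne)) s N J6" if "J5 s" for s
    unfolding N_def by (rule halts_within_fill_quadratic[where J=J5, OF _ _ _ computes_entry_op(3)[where m=m and n=n and p=p and R=1 and C=1]])
      (use that in \<open>auto simp: ival J_defs\<close>)
  have "halts_within decomposition_prog s (N + (N + (N + (N + (N + N))))) J6"
    unfolding decomposition_prog_def Let_def
    by (rule halts_within_Seq, rule halts_within_mono[OF 1 order_refl], simp add: J0_def s)
      (rule halts_within_Seq, rule halts_within_mono[OF 2 order_refl], assumption,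
       rule halts_within_Seq, rule halts_within_mono[OF 3 order_refl], assumption,
       rule halts_within_Seq, rule halts_within_mono[OF 4 order_refl], assumption,
       rule halts_within_Seq, rule halts_within_mono[OF 5 order_refl], assumption, rule 6)
  then show "halts_within decomposition_prog s (480 * ((m + n)\<^sup>2 + 1))
     (\<lambda>s'. stores_abc ''A_S'' ''b_S'' ''c_S'' (m + n) (core_abc m n p) s' \<and>
           stores_abc ''A_T'' ''b_T'' ''c_T'' (2 * m) (op_abc m p) s')"
    by (rule halts_within_mono) (simp add: N_def, simp add: J_defs stores_abcI)
qed

section \<open>Action of the operator\<close>

lemma sum_lessThan_add:
  fixes f :: "nat \<Rightarrow> 'a :: comm_monoid_add"
  shows "(\<Sum>a<m + n. f a) = (\<Sum>a<m. f a) + (\<Sum>a<n. f (m + a))"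
  by (induction n) (simp_all add: add.assoc)

text \<open>The two off-diagonal blocks contribute equally by symmetry of \<open>A\<close>, so the
  factor 1/2 disappears from the mixed term.\<close>

lemma gaussian_fun_append:
  fixes x v :: "complex vec"
  assumes p: "is_abc (m + n) p" and x: "x \<in> carrier_vec m" and v: "v \<in> carrier_vec n"
  shows "gaussian_fun p (x @\<^sub>v v) = abc_c p * exp (
    1 / 2 * (\<Sum>a<m. \<Sum>b<m. x $ a * abc_A p $$ (a, b) * x $ b) + (\<Sum>a<m. x $ a * abc_b p $ a)
    + (\<Sum>a<m. x $ a * (\<Sum>b<n. abc_A p $$ (a, m + b) * v $ b))
    + (1 / 2 * (\<Sum>a<n. \<Sum>b<n. v $ a * abc_A p $$ (m + a, m + b) * v $ b) + (\<Sum>a<n. v $ a * abc_b p $ (m + a))))"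
proof -
  have xv: "x @\<^sub>v v \<in> carrier_vec (m + n)" using x v by simp
  have l: "(x @\<^sub>v v) $ a = x $ a" if "a < m" for a using x v that by simp
  have h: "(x @\<^sub>v v) $ (m + a) = v $ a" if "a < n" for a using x v that by simp
  define C where "C = (\<Sum>a<m. x $ a * (\<Sum>b<n. abc_A p $$ (a, m + b) * v $ b))"
  have C1: "(\<Sum>a<m. \<Sum>b<n. x $ a * abc_A p $$ (a, m + b) * v $ b) = C"
    by (simp add: C_def sum_distrib_left mult.assoc)
  have C2: "(\<Sum>a<n. \<Sum>b<m. v $ a * abc_A p $$ (m + a, b) * x $ b) = C"
    unfolding C1[symmetric]
  proof (subst sum.swap, intro sum.cong refl)
    fix a b assume "a \<in> {..<m}" "b \<in> {..<n}"
    then have "abc_A p $$ (m + b, a) = abc_A p $$ (a, m + b)" by (intro is_abc_sym[OF p]) auto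
    then show "v $ b * abc_A p $$ (m + b, a) * x $ a = x $ a * abc_A p $$ (a, m + b) * v $ b" by simp
  qed
  show ?thesis
    unfolding gaussian_fun_eq_sums[OF p xv] C_def[symmetric]
    by (simp add: sum_lessThan_add l h sum.distrib C1 C2) (simp add: add_divide_distrib add_ac)
qed

lemma is_abc_core: "is_abc (m + n) p \<Longrightarrow> is_abc (m + n) (core_abc m n p)"
  by (auto simp: is_abc_def core_abc_def intro!: eq_matI is_abc_sym[of "m + n" p, unfolded is_abc_def])

lemma is_abc_op: "is_abc (m + n) p \<Longrightarrow> is_abc (2 * m) (op_abc m p)"
  by (auto simp: is_abc_def op_abc_def intro!: eq_matI is_abc_sym[of "m + n" p, unfolded is_abc_def])

text \<open>For fixed \<open>z\<close> and \<open>v\<close> the integrand is a constant times a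
  product over the modes. Each factor is an instance of \<open>complex_gaussian_integral\<close>,
  and the product theorems give both integrability and the value.\<close>

lemma op_maps_to_core:
  assumes p: "is_abc (m + n) p"
  shows "op_maps_to m n (gaussian_fun (op_abc m p)) (gaussian_fun (core_abc m n p)) (gaussian_fun p)"
  unfolding op_maps_to_def
proof (intro ballI)
  fix z v :: "complex vec" assume z: "z \<in> carrier_vec m" and v: "v \<in> carrier_vec n"
  let ?A = "abc_A p" and ?b = "abc_b p"
  \<comment> \<open>\<open>\<beta>\<close> is \<open>B v\<close>, the coefficient vector of
    \<open>w\<close> in the core exponent; \<open>K\<close> below collects everything independent of
    \<open>w\<close>.\<close>
  define \<beta> where "\<beta> i = (\<Sum>b<n. ?A $$ (i, m + b) * v $ b)" for i
  define ez where "ez = 1 / 2 * (\<Sum>a<m. \<Sum>b<m. z $ a * ?A $$ (a, b) * z $ b) + (\<Sum>a<m. z $ a * ?b $ a)"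
  define ev where "ev = 1 / 2 * (\<Sum>a<n. \<Sum>b<n. v $ a * ?A $$ (m + a, m + b) * v $ b) + (\<Sum>a<n. v $ a * ?b $ (m + a))"
  define K where "K = abc_c p * exp ez * exp ev"
  define f where "f i w = 1 / of_real pi * (of_real (exp (- (cmod w)\<^sup>2)) * exp (z $ i * cnj w + \<beta> i * w))" for i w
  interpret product_sigma_finite "\<lambda>_::nat. lborel :: complex measure" ..
  have f: "integrable lborel (f i)" "integral\<^sup>L lborel (f i) = exp (z $ i * \<beta> i)" for i
    using has_bochner_integral_mult_right[where c="1 / of_real pi", OF complex_gaussian_integral[of "z $ i" "\<beta> i"]]
    unfolding f_def has_bochner_integral_iff by simp_all
  have core: "gaussian_fun (core_abc m n p) (Matrix.vec m w @\<^sub>v v) = abc_c p * exp ((\<Sum>i<m. \<beta> i * w i) + ev)" for w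
    by (subst gaussian_fun_append[OF is_abc_core[OF p] _ v])
      (simp_all add: core_abc_def \<beta>_def ev_def mult.commute)
  have op: "gaussian_fun (op_abc m p) (z @\<^sub>v conjugate (Matrix.vec m w)) = exp (ez + (\<Sum>i<m. z $ i * cnj (w i)))" for w
  proof -
    \<comment> \<open>Row \<open>a\<close> of the off-diagonal block is a unit vector: the second
      alternative cannot occur for \<open>a < m\<close>.\<close>
    have "(\<Sum>b<m. (if m + b = a + m \<or> a = m + b + m then 1 else 0) * cnj (w b)) = cnj (w a)" if "a < m" for a
    proof -
      have "(\<Sum>b<m. (if m + b = a + m \<or> a = m + b + m then 1 else 0) * cnj (w b)) =
          (\<Sum>b<m. if b = a then cnj (w b) else 0)"
        using that by (intro sum.cong) auto
      then show ?thesis using that by (simp add: sum.delta)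
    qed
    then show ?thesis
      by (subst gaussian_fun_append[OF is_abc_op[OF p, unfolded mult_2] z])
        (simp_all add: op_abc_def ez_def)
  qed
  have integrand: "op_integrand m (gaussian_fun (op_abc m p)) (gaussian_fun (core_abc m n p)) z v = (\<lambda>w. K * (\<Prod>i<m. f i (w i)))"
  proof
    fix w
    have "exp ((\<Sum>i<m. z $ i * cnj (w i)) + (\<Sum>i<m. \<beta> i * w i)) = (\<Prod>i<m. exp (z $ i * cnj (w i) + \<beta> i * w i))"
      by (simp add: exp_add exp_sum prod.distrib)
    then have "(\<Prod>i<m. f i (w i)) = of_real (exp (- (\<Sum>i<m. (cmod (w i))\<^sup>2)) / pi ^ m) *
        exp ((\<Sum>i<m. z $ i * cnj (w i)) + (\<Sum>i<m. \<beta> i * w i))"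
      by (simp add: f_def prod.distrib prod_dividef exp_sum flip: sum_negf of_real_prod)
    then show "op_integrand m (gaussian_fun (op_abc m p)) (gaussian_fun (core_abc m n p)) z v w = K * (\<Prod>i<m. f i (w i))"
      by (simp add: op_integrand_def core op K_def exp_add)
  qed
  have "gaussian_fun p (z @\<^sub>v v) = K * (\<Prod>i<m. exp (z $ i * \<beta> i))"
    by (subst gaussian_fun_append[OF p z v]) (simp add: K_def ez_def ev_def \<beta>_def exp_add exp_sum)
  then show "integrable (\<Pi>\<^sub>M i\<in>{..<m}. lborel) (op_integrand m (gaussian_fun (op_abc m p)) (gaussian_fun (core_abc m n p)) z v) \<and>
      gaussian_fun p (z @\<^sub>v v) = (LINT w|(\<Pi>\<^sub>M i\<in>{..<m}. lborel).
        op_integrand m (gaussian_fun (op_abc m p)) (gaussian_fun (core_abc m n p)) z v w)"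
    unfolding integrand
    using product_integrable_prod[of "{..<m}" f] product_integral_prod[of "{..<m}" f] f by simp
qed

theorem proposition3:
  shows "\<exists>P QA_S Qb_S QA_T Qb_T C K. \<forall>m n G pG. has_abc (m + n) G pG \<longrightarrow>
    (\<exists>S T pS pT.
       gaussian_core_vector m n S \<and> has_abc (m + n) S pS \<and>
       gaussian_operator m T \<and> has_abc (2 * m) T pT \<and>
       op_maps_to m n T S G \<and>
       computes_decomposition P (C * ((m + n)\<^sup>2 + 1)) m n pG pS pT \<and>
       computes_Ab_entries QA_S Qb_S K m n pG (m + n) pS \<and>
       computes_Ab_entries QA_T Qb_T K m n pG (2 * m) pT)"
proof (intro exI allI impI conjI)
  \<comment> \<open>The witnesses are still schematic and are fixed by the claims below; programs
    and constants are bound outside \<open>m\<close>, \<open>n\<close> and \<open>G\<close>, so they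
    cannot depend on these.\<close>
  fix m n G pG assume G: "has_abc (m + n) G pG"
  then have p: "is_abc (m + n) pG" by (simp add: has_abc_def)
  let ?S = "gaussian_fun (core_abc m n pG)" and ?T = "gaussian_fun (op_abc m pG)"
  show S: "has_abc (m + n) ?S (core_abc m n pG)" using is_abc_core[OF p] by (simp add: has_abc_def)
  show "gaussian_core_vector m n ?S"
    by (rule gaussian_core_vectorI[OF S]) (simp_all add: core_abc_def)
  show T: "has_abc (2 * m) ?T (op_abc m pG)" using is_abc_op[OF p] by (simp add: has_abc_def)
  then show "gaussian_operator m ?T" by (auto simp: gaussian_operator_def)
  \<comment> \<open>\<open>G\<close> agrees with its Gaussian function only on the carrier, which
    contains every \<open>z @\<^sub>v v\<close> at which it is evaluated.\<close>
  show "op_maps_to m n ?T ?S G"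
    using op_maps_to_core[OF p] G by (simp add: op_maps_to_def has_abc_def)
  show "computes_decomposition decomposition_prog (480 * ((m + n)\<^sup>2 + 1)) m n pG (core_abc m n pG) (op_abc m pG)"
    by (rule decomposition_prog_correct)
  show "computes_Ab_entries entry_A_S entry_b_S 4 m n pG (m + n) (core_abc m n pG)"
    by (intro computes_Ab_entriesI computes_entry_core)
  show "computes_Ab_entries entry_A_T entry_b_T 4 m n pG (2 * m) (op_abc m pG)"
    by (intro computes_Ab_entriesI computes_entry_op)
qed

end
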